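(* Let $\varepsilon_0,\dots,\varepsilon_6\in(0,1)$ and consider the channel from levels $\{B_0,\dots,B_7\}$ to outputs $\{s_0,\dots,s_7\}$ with transition matrix $p^E_{TLC}(y|v)$ given by $p^E_{TLC}(s_i|B_i)=\varepsilon_i$ and $p^E_{TLC}(s_{i+1}|B_i)=1-\varepsilon_i$ for $i=0,\dots,6$, $p^E_{TLC}(s_7|B_7)=1$, and all other entries $0$. Then the uniform rate regions satisfy $$\mathscr R_{NO}^{TIN}\subset\mathscr R_G^{TIN}=\mathscr R_G^{SC}\subset\mathscr R_{NO}^{SC},$$ where $\subset$ denotes strict inclusion.
   Context: A labeling $\sigma=(w_0,\dots,w_7)$, an ordering of the eight 3-bit strings, maps the input $(X_1,X_2,X_3)=w_i$ to level $B_i$. Gray labeling: $\sigma_G=(111,110,100,101,001,000,010,011)$. Natural Order labeling: $\sigma_{NO}=(111,110,101,100,011,010,001,000)$. Given a labeling $\sigma$, the inputs $X_1,X_2,X_3$ are independent and uniform on $\{0,1\}$ and $P(Y=y|X_1=x_1,X_2=x_2,X_3=x_3)=p^E_{TLC}(y\,|\,\sigma(x_1x_2x_3))$. Mutual informations use logarithms to base 2. Subscripts $G,NO$ indicate the labeling used. TIN: $\mathscr R^{TIN}=\{(R_1,R_2,R_3):0\le R_i\le I(X_i;Y),\ i=1,2,3\}$. SC: $\mathscr R^{SC}$ is the set of $(R_1,R_2,R_3)$ with $R_1,R_2,R_3\ge0$ and $R_1\le I(X_1;Y|X_2,X_3)$, $R_2\le I(X_2;Y|X_1,X_3)$, $R_3\le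 I(X_3;Y|X_1,X_2)$; $R_1+R_2\le I(X_1,X_2;Y|X_3)$, $R_1+R_3\le I(X_1,X_3;Y|X_2)$, $R_2+R_3\le I(X_2,X_3;Y|X_1)$; $R_1+R_2+R_3\le I(X_1,X_2,X_3;Y)$. *)

theory Defs
  imports "HOL-Probability.Probability"
begin

type_synonym bits3 = "bool \<times> bool \<times> bool"

(* Bit value 1 is True. The i-th entry of a labeling is the 3-bit string sent to level i. *)

definition gray_labeling :: "bits3 list" where
  "gray_labeling =
    [(True, True, True), (True, True, False), (True, False, False), (True, False, True),
     (False, False, True), (False, False, False), (False, True, False), (False, True, True)]"

definition natural_order_labeling :: "bits3 list" where
  "natural_order_labeling =
    [(True, True, True), (True, True, False), (True, False, True), (True, False, False),
     (False, True, True), (False, True, False), (False, False, True), (False, False, False)]"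

definition level_of :: "bits3 list \<Rightarrow> bits3 \<Rightarrow> nat" where
  "level_of \<sigma> x = (THE i. i < length \<sigma> \<and> \<sigma> ! i = x)"

(* Level B_i and output s_i are both represented by the number i; only levels 0, ..., 7 matter.
   The lemma pmf_tlc_channel gives the transition matrix. *)
definition tlc_channel :: "(nat \<Rightarrow> real) \<Rightarrow> nat \<Rightarrow> nat pmf" where
  "tlc_channel \<epsilon> v =
    (if v < 7 then map_pmf (\<lambda>stay. if stay then v else v + 1) (bernoulli_pmf (\<epsilon> v))
     else return_pmf 7)"

definition input_law :: "bits3 pmf" where
  "input_law = pair_pmf (pmf_of_set UNIV) (pair_pmf (pmf_of_set UNIV) (pmf_of_set UNIV))"

definition joint_law :: "(nat \<Rightarrow> nat pmf) \<Rightarrow> bits3 list \<Rightarrow> (bits3 \<times> nat) pmf" where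
  "joint_law W \<sigma> =
    bind_pmf input_law (\<lambda>x. map_pmf (\<lambda>y. (x, y)) (W (level_of \<sigma> x)))"

definition X1 :: "bits3 \<times> nat \<Rightarrow> bool" where "X1 = (\<lambda>((x1, x2, x3), y). x1)"
definition X2 :: "bits3 \<times> nat \<Rightarrow> bool" where "X2 = (\<lambda>((x1, x2, x3), y). x2)"
definition X3 :: "bits3 \<times> nat \<Rightarrow> bool" where "X3 = (\<lambda>((x1, x2, x3), y). x3)"
definition Y :: "bits3 \<times> nat \<Rightarrow> nat" where "Y = (\<lambda>(x, y). y)"

definition mutual_info :: "'w pmf \<Rightarrow> ('w \<Rightarrow> 'a) \<Rightarrow> ('w \<Rightarrow> 'b) \<Rightarrow> real" where
  "mutual_info p U V =
    prob_space.mutual_information (measure_pmf p) 2 (count_space UNIV) (count_space UNIV) U V"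

definition cond_mutual_info ::
    "'w pmf \<Rightarrow> ('w \<Rightarrow> 'a) \<Rightarrow> ('w \<Rightarrow> 'b) \<Rightarrow> ('w \<Rightarrow> 'c) \<Rightarrow> real" where
  "cond_mutual_info p U V Z =
    prob_space.conditional_mutual_information (measure_pmf p) 2
      (count_space UNIV) (count_space UNIV) (count_space UNIV) U V Z"

definition joint :: "('w \<Rightarrow> 'a) \<Rightarrow> ('w \<Rightarrow> 'b) \<Rightarrow> 'w \<Rightarrow> 'a \<times> 'b" where
  "joint U V = (\<lambda>w. (U w, V w))"

definition TIN_region :: "(nat \<Rightarrow> nat pmf) \<Rightarrow> bits3 list \<Rightarrow> (real \<times> real \<times> real) set" where
  "TIN_region W \<sigma> = (let p = joint_law W \<sigma> in
    {(R1, R2, R3).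
      0 \<le> R1 \<and> R1 \<le> mutual_info p X1 Y \<and>
      0 \<le> R2 \<and> R2 \<le> mutual_info p X2 Y \<and>
      0 \<le> R3 \<and> R3 \<le> mutual_info p X3 Y})"

definition SC_region :: "(nat \<Rightarrow> nat pmf) \<Rightarrow> bits3 list \<Rightarrow> (real \<times> real \<times> real) set" where
  "SC_region W \<sigma> = (let p = joint_law W \<sigma> in
    {(R1, R2, R3).
      0 \<le> R1 \<and> 0 \<le> R2 \<and> 0 \<le> R3 \<and>
      R1 \<le> cond_mutual_info p X1 Y (joint X2 X3) \<and>
      R2 \<le> cond_mutual_info p X2 Y (joint X1 X3) \<and>
      R3 \<le> cond_mutual_info p X3 Y (joint X1 X2) \<and>
      R1 + R2 \<le> cond_mutual_info p (joint X1 X2) Y X3 \<and>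
      R1 + R3 \<le> cond_mutual_info p (joint X1 X3) Y X2 \<and>
      R2 + R3 \<le> cond_mutual_info p (joint X2 X3) Y X1 \<and>
      R1 + R2 + R3 \<le> mutual_info p (joint X1 (joint X2 X3)) Y})"

lemma pmf_tlc_channel:
  assumes "\<And>i. i \<le> 6 \<Longrightarrow> 0 < \<epsilon> i \<and> \<epsilon> i < 1" and "v \<le> 7"
  shows "pmf (tlc_channel \<epsilon> v) y =
    (if v = 7 then (if y = 7 then 1 else 0)
     else if y = v then \<epsilon> v else if y = v + 1 then 1 - \<epsilon> v else 0)"
proof (cases "v = 7")
  case True
  then show ?thesis by (simp add: tlc_channel_def)
next
  case False
  with assms(2) have v: "v \<le> 6" by simp
  have e: "0 \<le> \<epsilon> v" "\<epsilon> v \<le> 1" using assms(1)[OF v] by auto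
  have "map_pmf (\<lambda>b. if b then v else v + 1) (bernoulli_pmf (\<epsilon> v)) =
      bind_pmf (bernoulli_pmf (\<epsilon> v)) (\<lambda>b. return_pmf (if b then v else v + 1))"
    by (simp add: map_pmf_def)
  then show ?thesis
    using False v e by (auto simp: tlc_channel_def pmf_bind)
qed

lemma pmf_joint_law: "pmf (joint_law W \<sigma>) (x, y) = 1 / 8 * pmf (W (level_of \<sigma> x)) y"
proof -
  have fst: "pmf (map_pmf (Pair x') q) (x, y) = (if x' = x then pmf q y else 0)" for x' and q :: "nat pmf"
  proof (cases "x' = x")
    case True
    then show ?thesis by (simp add: pmf_map_inj' inj_on_def)
  next
    case False
    then have "(x, y) \<notin> set_pmf (map_pmf (Pair x') q)" by auto
    then have "pmf (map_pmf (Pair x') q) (x, y) = 0" unfolding set_pmf_iff by blast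
    with False show ?thesis by simp
  qed
  have "pmf input_law x = 1 / 8"
    by (cases x) (simp add: input_law_def pmf_pair)
  moreover have "pmf (joint_law W \<sigma>) (x, y) =
      (\<Sum>x'\<in>UNIV. (if x' = x then pmf (W (level_of \<sigma> x)) y * pmf input_law x else 0))"
    unfolding joint_law_def pmf_bind
    by (subst integral_measure_pmf_real[where A = UNIV])
      (auto simp: fst simp del: sum.delta sum.delta' intro!: sum.cong)
  ultimately show ?thesis by simp
qed

lemma level_of_nth:
  assumes "\<sigma> \<in> {gray_labeling, natural_order_labeling}" and "i < 8"
  shows "level_of \<sigma> (\<sigma> ! i) = i"
proof -
  have "distinct \<sigma>" "length \<sigma> = 8"
    using assms(1) by (auto simp: gray_labeling_def natural_order_labeling_def)
  then show ?thesis
    using assms(2) unfolding level_of_def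
    by (auto simp: nth_eq_iff_index_eq intro!: the_equality)
qed

end

theory Submission imports Defs begin

text \<open>
  Output \<open>y\<close> can only stem from the levels \<open>y - 1\<close> and \<open>y\<close>. A fixed output therefore leaves
  at most one binary ambiguity, of positive contribution \<open>h y = P(Y = y) H(level | Y = y)\<close>, and this
  ambiguity affects an input (or a group of inputs) only if the labels of the two levels differ there
  while the side information agrees on them. Under the Gray labeling adjacent levels
  differ in exactly one bit, so side information never helps, and each sum constraint is implied by
  the individual ones. Under the natural order the contributions \<open>h 2\<close>, \<open>h 4\<close>, \<open>h 6\<close> are charged
  to several inputs when interference is treated as noise, which shrinks the TIN region; conditioning
  on both other inputs removes them, which enlarges the SC region. The total rate
  \<open>3 - (h 1 + ... + h 7)\<close> is the same for both labelings and exceeds 2.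
\<close>

section \<open>Mutual information as a finite sum\<close>

text \<open>The integral of the log density ratio is pulled back along \<open>joint U V\<close>, so
  the sum runs over sample points and never needs the range of \<open>U\<close> or \<open>V\<close>.
  Countability makes the product of the counting measures a counting measure.\<close>

lemma mutual_info_finite_sum:
  fixes U :: "'w \<Rightarrow> 'a::countable" and V :: "'w \<Rightarrow> 'b::countable"
  assumes "finite A" "set_pmf p \<subseteq> A"
  shows "mutual_info p U V = (\<Sum>w\<in>A. pmf p w * log 2
    (pmf (map_pmf (joint U V) p) (joint U V w) / (pmf (map_pmf U p) (U w) * pmf (map_pmf V p) (V w))))"
proof -
  interpret information_space "measure_pmf p" 2
    by unfold_locales simp
  have distr: "distributed (measure_pmf p) (count_space UNIV) F (\<lambda>z. ennreal (pmf (map_pmf F p) z))"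
    for F :: "'w \<Rightarrow> 'c"
    by (simp add: distributed_def map_pmf_rep_eq[symmetric] measure_pmf_eq_density[symmetric])
  have UV: "count_space UNIV \<Otimes>\<^sub>M count_space UNIV = (count_space UNIV :: ('a \<times> 'b) measure)"
    by (simp add: pair_measure_countable)
  define g where "g z = log 2
    (pmf (map_pmf (joint U V) p) z / (pmf (map_pmf U p) (fst z) * pmf (map_pmf V p) (snd z)))" for z
  have "mutual_info p U V = (\<integral>z. pmf (map_pmf (joint U V) p) z * g z
      \<partial>(count_space UNIV \<Otimes>\<^sub>M count_space UNIV))"
    unfolding mutual_info_def g_def
    by (rule mutual_information_distr[where Px = "pmf (map_pmf U p)" and Py = "pmf (map_pmf V p)"])
      (use distr[of "joint U V"] in \<open>auto simp: UV joint_def sigma_finite_measure_count_space intro: distr\<close>)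
  also have "\<dots> = (\<integral>z. g z \<partial>measure_pmf (map_pmf (joint U V) p))"
    unfolding UV measure_pmf_eq_density by (subst integral_density) auto
  also have "\<dots> = (\<integral>w. g (joint U V w) \<partial>measure_pmf p)"
    by simp
  also have "\<dots> = (\<Sum>w\<in>A. g (joint U V w) * pmf p w)"
    using assms by (intro integral_measure_pmf_real) auto
  finally show ?thesis
    by (simp add: g_def joint_def mult.commute)
qed

text \<open>The library defines I(U;V|Z) by the chain rule; only the measure on pairs has to be
  identified.\<close>

lemma cond_mutual_info_chain:
  fixes V :: "'w \<Rightarrow> 'b::countable" and Z :: "'w \<Rightarrow> 'c::countable"
  shows "cond_mutual_info p U V Z = mutual_info p U (joint V Z) - mutual_info p U Z"
  unfolding cond_mutual_info_def mutual_info_def joint_def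
    prob_space.conditional_mutual_information_def[OF prob_space_measure_pmf]
  by (simp add: pair_measure_countable)

lemma pmf_map_pmf_self:
  assumes "finite A" "set_pmf p \<subseteq> A"
  shows "pmf (map_pmf f p) (f w) = (\<Sum>w'\<in>A. pmf p w' * of_bool (f w' = f w))"
proof -
  have "pmf (map_pmf f p) (f w) = measure p (f -` {f w})"
    by (simp add: pmf_map)
  also have "\<dots> = (\<integral>w'. indicator (f -` {f w}) w' \<partial>p)"
    by simp
  also have "\<dots> = (\<integral>w'. of_bool (f w' = f w) \<partial>p)"
    by (simp add: indicator_def)
  also have "\<dots> = (\<Sum>w'\<in>A. of_bool (f w' = f w) * pmf p w')"
    using assms by (intro integral_measure_pmf_real) auto
  finally show ?thesis by (simp add: mult.commute)
qed

section \<open>Joint masses and binary ambiguity\<close>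

text \<open>Joint mass of level \<open>y\<close> and output \<open>y\<close>, each level having
  probability 1/8. Level 7 is noiseless and \<epsilon> 7 is unconstrained, hence the case
  distinction.\<close>

definition stay_mass :: "(nat \<Rightarrow> real) \<Rightarrow> nat \<Rightarrow> real" where
  "stay_mass \<epsilon> y = (if y = 7 then 1 else \<epsilon> y) / 8"

text \<open>Mass of output \<open>y\<close> reached from level \<open>y - 1\<close>; meaningless for \<open>y = 0\<close>.\<close>

definition shift_mass :: "(nat \<Rightarrow> real) \<Rightarrow> nat \<Rightarrow> real" where
  "shift_mass \<epsilon> y = (1 - \<epsilon> (y - 1)) / 8"

text \<open>For masses a and b this is (a + b) times the binary entropy of a / (a + b).\<close>

definition ambiguity :: "(nat \<Rightarrow> real) \<Rightarrow> nat \<Rightarrow> real" where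
  "ambiguity \<epsilon> y =
    stay_mass \<epsilon> y * log 2 ((stay_mass \<epsilon> y + shift_mass \<epsilon> y) / stay_mass \<epsilon> y) +
    shift_mass \<epsilon> y * log 2 ((stay_mass \<epsilon> y + shift_mass \<epsilon> y) / shift_mass \<epsilon> y)"

lemma entropy_term_pos:
  fixes a b :: real
  assumes "0 < a" "0 < b"
  shows "0 < a * log 2 ((a + b) / a) + b * log 2 ((a + b) / b)"
  using assms by (intro add_pos_pos mult_pos_pos) (auto simp: field_simps)

text \<open>A binary entropy is at most one bit: by ln t \<le> t - 1 the deviations from the uniform
  case are at most (b - a)/2 and (a - b)/2, which cancel.\<close>

lemma entropy_term_le:
  fixes a b :: real
  assumes "0 < a" "0 < b"
  shows "a * log 2 ((a + b) / a) + b * log 2 ((a + b) / b) \<le> a + b"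
proof -
  have ln: "x * ln ((x + y) / (2 * x)) \<le> (y - x) / 2" if "0 < x" "0 < y" for x y :: real
  proof -
    have "x * ln ((x + y) / (2 * x)) \<le> x * ((x + y) / (2 * x) - 1)"
      using that by (intro mult_left_mono ln_le_minus_one) auto
    also have "\<dots> = (y - x) / 2" using that by (simp add: field_simps)
    finally show ?thesis .
  qed
  \<comment> \<open>Compare with the uniform case \<open>a = b\<close>, where both logarithms equal 1.\<close>
  have half: "log 2 ((x + y) / x) = 1 + ln ((x + y) / (2 * x)) / ln 2" if "0 < x" "0 < y" for x y :: real
  proof -
    have "(x + y) / x = 2 * ((x + y) / (2 * x))" using that by (simp add: field_simps)
    then have "log 2 ((x + y) / x) = log 2 (2 * ((x + y) / (2 * x)))" by (simp only:)
    also have "\<dots> = 1 + log 2 ((x + y) / (2 * x))" using that by (subst log_mult) auto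
    finally show ?thesis by (simp add: log_def)
  qed
  have "a * log 2 ((a + b) / a) + b * log 2 ((b + a) / b) =
      a + b + (a * ln ((a + b) / (2 * a)) + b * ln ((b + a) / (2 * b))) / ln 2"
    using half[of a b] half[of b a] assms by (simp add: algebra_simps add_divide_distrib)
  also have "\<dots> \<le> a + b"
    using ln[of a b] ln[of b a] assms by (simp add: divide_le_0_iff)
  finally show ?thesis by (simp add: add.commute)
qed

section \<open>Joint law of input and output\<close>

text \<open>The two labelings are treated together until the equivocations are evaluated.\<close>

locale tlc =
  fixes \<epsilon> :: "nat \<Rightarrow> real" and \<sigma> :: "bits3 list"
  assumes eps: "\<And>i. i \<le> 6 \<Longrightarrow> 0 < \<epsilon> i \<and> \<epsilon> i < 1"
    and labeling: "\<sigma> \<in> {gray_labeling, natural_order_labeling}"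
begin

abbreviation p where "p \<equiv> joint_law (tlc_channel \<epsilon>) \<sigma>"

lemma stay_mass_pos: "y \<le> 7 \<Longrightarrow> 0 < stay_mass \<epsilon> y"
  using eps[of y] by (auto simp: stay_mass_def)

lemma shift_mass_pos: "1 \<le> y \<Longrightarrow> y \<le> 7 \<Longrightarrow> 0 < shift_mass \<epsilon> y"
  using eps[of "y - 1"] by (auto simp: shift_mass_def)

lemma bij_nth: "bij_betw ((!) \<sigma>) {..<8} UNIV"
proof -
  have inj: "inj_on ((!) \<sigma>) {..<8}"
    by (rule inj_on_inverseI[where g = "level_of \<sigma>"]) (simp add: level_of_nth[OF labeling])
  then have "card ((!) \<sigma> ` {..<8}) = card (UNIV :: bits3 set)"
    by (simp add: card_image card_prod)
  then have "(!) \<sigma> ` {..<8} = UNIV" by (rule card_subset_eq[OF finite subset_UNIV])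
  with inj show ?thesis by (simp add: bij_betw_def)
qed

text \<open>The guard \<open>y \<le> 7\<close> excludes a shift from level 7 to a nonexistent output
  8.\<close>

lemma pmf_nth:
  assumes "i < 8"
  shows "pmf p (\<sigma> ! i, y) =
    (if y = i then stay_mass \<epsilon> y else 0) + (if y = i + 1 \<and> y \<le> 7 then shift_mass \<epsilon> y else 0)"
proof -
  have "pmf (tlc_channel \<epsilon> i) y =
    (if i = 7 then (if y = 7 then 1 else 0)
     else if y = i then \<epsilon> i else if y = i + 1 then 1 - \<epsilon> i else 0)"
    using assms by (intro pmf_tlc_channel) (auto dest: eps)
  then show ?thesis
    using assms by (auto simp: pmf_joint_law level_of_nth[OF labeling] stay_mass_def shift_mass_def)
qed

lemma sum_joint_row:
  assumes "y \<le> 7"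
  shows "(\<Sum>x\<in>UNIV. pmf p (x, y) * G x) =
    stay_mass \<epsilon> y * G (\<sigma> ! y) + (if y = 0 then 0 else shift_mass \<epsilon> y * G (\<sigma> ! (y - 1)))"
proof -
  have "(\<Sum>x\<in>UNIV. pmf p (x, y) * G x) = (\<Sum>i<8. pmf p (\<sigma> ! i, y) * G (\<sigma> ! i))"
    by (rule sum.reindex_bij_betw[OF bij_nth, symmetric])
  \<comment> \<open>At \<open>y = 0\<close> truncated subtraction gives \<open>y - 1 = y\<close>;
    the inner conditional suppresses the spurious second source.\<close>
  also have "\<dots> = (\<Sum>i<8. (if i = y then stay_mass \<epsilon> y * G (\<sigma> ! y) else 0) +
      (if i = y - 1 then if y = 0 then 0 else shift_mass \<epsilon> y * G (\<sigma> ! (y - 1)) else 0))"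
    using assms by (intro sum.cong refl) (auto simp: pmf_nth)
  finally show ?thesis using assms by (simp add: sum.distrib)
qed

lemma set_pmf_subset: "set_pmf p \<subseteq> UNIV \<times> {..7}"
proof
  fix w assume w: "w \<in> set_pmf p"
  obtain i where i: "i < 8" "fst w = \<sigma> ! i"
    using bij_betw_imp_surj_on[OF bij_nth] by (metis UNIV_I imageE lessThan_iff)
  have "pmf p (\<sigma> ! i, snd w) \<noteq> 0" using w i by (metis prod.collapse set_pmf_iff)
  then show "w \<in> UNIV \<times> {..7}" using i by (auto simp: pmf_nth mem_Times_iff split: if_splits)
qed

lemma sum_cells: "(\<Sum>w\<in>UNIV \<times> {..7}. F w) = (\<Sum>y\<le>7. \<Sum>x\<in>UNIV. F (x, y))"
  for F :: "bits3 \<times> nat \<Rightarrow> real"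
  by (subst sum.swap) (simp add: sum.cartesian_product)

text \<open>Only 15 cells carry mass: output 0 has one source, each of the outputs 1 to 7 has
  two.\<close>

lemma sum_support:
  "(\<Sum>w\<in>UNIV \<times> {..7}. pmf p w * G w) =
    stay_mass \<epsilon> 0 * G (\<sigma> ! 0, 0) +
    (\<Sum>y=1..7. stay_mass \<epsilon> y * G (\<sigma> ! y, y) + shift_mass \<epsilon> y * G (\<sigma> ! (y - 1), y))"
proof -
  have "(\<Sum>w\<in>UNIV \<times> {..7}. pmf p w * G w) = (\<Sum>y\<le>7. \<Sum>x\<in>UNIV. pmf p (x, y) * G (x, y))"
    by (rule sum_cells)
  also have "\<dots> = (\<Sum>y\<in>insert 0 {1..7}. stay_mass \<epsilon> y * G (\<sigma> ! y, y) +
      (if y = 0 then 0 else shift_mass \<epsilon> y * G (\<sigma> ! (y - 1), y)))"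
    by (intro sum.cong) (auto simp: sum_joint_row)
  also have "\<dots> = stay_mass \<epsilon> 0 * G (\<sigma> ! 0, 0) +
    (\<Sum>y=1..7. stay_mass \<epsilon> y * G (\<sigma> ! y, y) + (if y = 0 then 0 else shift_mass \<epsilon> y * G (\<sigma> ! (y - 1), y)))"
    by (subst sum.insert) auto
  also have "(\<Sum>y=1..7. stay_mass \<epsilon> y * G (\<sigma> ! y, y) + (if y = 0 then 0 else shift_mass \<epsilon> y * G (\<sigma> ! (y - 1), y))) =
    (\<Sum>y=1..7. stay_mass \<epsilon> y * G (\<sigma> ! y, y) + shift_mass \<epsilon> y * G (\<sigma> ! (y - 1), y))"
    by (intro sum.cong) auto
  finally show ?thesis .
qed

text \<open>Regrouped by level, each \<epsilon> i cancels and every level contributes 1/8.\<close>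

lemma total_mass: "stay_mass \<epsilon> 0 + (\<Sum>y=1..7. stay_mass \<epsilon> y + shift_mass \<epsilon> y) = 1"
  by (simp add: stay_mass_def shift_mass_def numeral_eq_Suc field_simps)

lemma map_fst_joint_law: "map_pmf fst p = input_law"
  by (simp add: joint_law_def map_bind_pmf map_pmf_comp bind_return_pmf')

lemma input_law_uniform: "input_law = pmf_of_set UNIV"
  by (rule pmf_eqI) (auto simp: input_law_def pmf_pair card_prod)

lemma pmf_map_input:
  "pmf (map_pmf (T \<circ> fst) p) (T x) = real (card {x'. T x' = T x}) / 8"
proof -
  have "map_pmf (T \<circ> fst) p = map_pmf T (pmf_of_set UNIV)"
    by (simp add: map_fst_joint_law[symmetric] input_law_uniform[symmetric] pmf.map_comp)
  then show ?thesis
    by (simp add: pmf_map measure_pmf_of_set vimage_def card_prod)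
qed

lemma pmf_map_input_nonzero: "pmf (map_pmf (T \<circ> fst) p) (T x) \<noteq> 0"
  by (cases x) (auto simp: pmf_map_input)

text \<open>Describing \<open>V\<close> only by which cells it identifies covers \<open>Y\<close>,
  \<open>joint Y (S \<circ> fst)\<close> and \<open>joint (T \<circ> fst) V\<close> alike.\<close>

lemma pmf_map_output:
  assumes V: "\<And>x y x' y'. V (x, y) = V (x', y') \<longleftrightarrow> y = y' \<and> S x = S x'" and "y \<le> 7"
  shows "pmf (map_pmf V p) (V (x, y)) = stay_mass \<epsilon> y * of_bool (S (\<sigma> ! y) = S x) +
    (if y = 0 then 0 else shift_mass \<epsilon> y * of_bool (S (\<sigma> ! (y - 1)) = S x))"
proof -
  have "pmf (map_pmf V p) (V (x, y)) =
      (\<Sum>w\<in>UNIV \<times> {..7}. pmf p w * of_bool (V w = V (x, y)))"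
    using set_pmf_subset by (intro pmf_map_pmf_self) auto
  also have "\<dots> = (\<Sum>y'\<le>7. \<Sum>x'\<in>UNIV. pmf p (x', y') * of_bool (V (x', y') = V (x, y)))"
    by (rule sum_cells)
  also have "\<dots> = (\<Sum>y'\<le>7. if y' = y then \<Sum>x'\<in>UNIV. pmf p (x', y) * of_bool (S x' = S x) else 0)"
    by (intro sum.cong) (auto simp: V)
  also have "\<dots> = (\<Sum>x'\<in>UNIV. pmf p (x', y) * of_bool (S x' = S x))"
    using assms(2) by simp
  finally show ?thesis by (simp only: sum_joint_row[OF assms(2)])
qed

section \<open>Mutual information through equivocation\<close>

lemma X_comp:
  "X1 = fst \<circ> fst" "X2 = (fst \<circ> snd) \<circ> fst" "X3 = (snd \<circ> snd) \<circ> fst"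
  by (auto simp: X1_def X2_def X3_def)

lemma joint_comp: "joint (T \<circ> fst) (S \<circ> fst) = (\<lambda>x. (T x, S x)) \<circ> fst"
  by (auto simp: joint_def)

text \<open>The hypothesis is P(T, S) = P(T) P(S) multiplied by 64, so every logarithm is log
  1.\<close>

lemma mutual_info_inputs_indep:
  fixes T :: "bits3 \<Rightarrow> 'a::countable" and S :: "bits3 \<Rightarrow> 'b::countable"
  assumes "\<And>x. 8 * card {x'. T x' = T x \<and> S x' = S x} = card {x'. T x' = T x} * card {x'. S x' = S x}"
  shows "mutual_info p (T \<circ> fst) (S \<circ> fst) = 0"
proof -
  have *: "pmf (map_pmf ((\<lambda>x. (T x, S x)) \<circ> fst) p) (T x, S x) =
      pmf (map_pmf (T \<circ> fst) p) (T x) * pmf (map_pmf (S \<circ> fst) p) (S x)" for x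
    using pmf_map_input[of "\<lambda>x. (T x, S x)" x] assms[of x, THEN arg_cong[of _ _ real]]
    by (simp add: pmf_map_input[of T x] pmf_map_input[of S x])
  show ?thesis
    by (subst mutual_info_finite_sum[OF _ set_pmf_subset])
      (auto simp: joint_comp * pmf_map_input_nonzero intro!: sum.neutral)
qed

text \<open>The conditional entropy \<open>H(T | Y, S)\<close>.\<close>

definition equivocation :: "(bits3 \<Rightarrow> 'b) \<Rightarrow> (bits3 \<Rightarrow> 'a) \<Rightarrow> real" where
  "equivocation S T = (\<Sum>y=1..7.
    if S (\<sigma> ! (y - 1)) = S (\<sigma> ! y) \<and> T (\<sigma> ! (y - 1)) \<noteq> T (\<sigma> ! y) then ambiguity \<epsilon> y else 0)"

text \<open>This is I(T;V) = H(T) - H(T|V) with \<open>V\<close> equivalent to (Y, S). Fibres of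
  equal size 8/m make \<open>T\<close> uniform on m values, so H(T) = log m.\<close>

lemma mutual_info_input_output:
  fixes T :: "bits3 \<Rightarrow> 'a::countable" and V :: "bits3 \<times> nat \<Rightarrow> 'b::countable"
  assumes V: "\<And>x y x' y'. V (x, y) = V (x', y') \<longleftrightarrow> y = y' \<and> S x = S x'"
    and T: "\<And>x. card {x'. T x' = T x} * m = 8"
  shows "mutual_info p (T \<circ> fst) V = log 2 m - equivocation S T"
proof -
  have m: "0 < m" using T[of undefined] by (cases m) auto
  define J where "J = joint (T \<circ> fst) V"
  have J: "J (x, y) = J (x', y') \<longleftrightarrow> y = y' \<and> (T x, S x) = (T x', S x')" for x y x' y'
    by (auto simp: J_def joint_def V)
  have PT: "pmf (map_pmf (T \<circ> fst) p) (T x) = 1 / m" for x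
  proof -
    have "real (card {x'. T x' = T x}) * m = 8"
      using T[of x] by (metis of_nat_mult of_nat_numeral)
    then show ?thesis using m by (simp add: pmf_map_input field_simps)
  qed
  define G where "G w = log 2 (pmf (map_pmf J p) (J w) / (1 / m * pmf (map_pmf V p) (V w)))" for w
  have "mutual_info p (T \<circ> fst) V = (\<Sum>w\<in>UNIV \<times> {..7}. pmf p w * G w)"
    by (subst mutual_info_finite_sum[OF _ set_pmf_subset]) (auto simp: PT G_def J_def)
  also have "\<dots> = stay_mass \<epsilon> 0 * G (\<sigma> ! 0, 0) +
    (\<Sum>y=1..7. stay_mass \<epsilon> y * G (\<sigma> ! y, y) + shift_mass \<epsilon> y * G (\<sigma> ! (y - 1), y))"
    by (rule sum_support)
  \<comment> \<open>Output 0 reveals level 0, so the density ratio is m.\<close>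
  also have "stay_mass \<epsilon> 0 * G (\<sigma> ! 0, 0) = stay_mass \<epsilon> 0 * log 2 m"
    using stay_mass_pos[of 0] by (simp add: G_def pmf_map_output[OF V] pmf_map_output[OF J])
  also have "(\<Sum>y=1..7. stay_mass \<epsilon> y * G (\<sigma> ! y, y) + shift_mass \<epsilon> y * G (\<sigma> ! (y - 1), y)) =
    (\<Sum>y=1..7. (stay_mass \<epsilon> y + shift_mass \<epsilon> y) * log 2 m -
      (if S (\<sigma> ! (y - 1)) = S (\<sigma> ! y) \<and> T (\<sigma> ! (y - 1)) \<noteq> T (\<sigma> ! y) then ambiguity \<epsilon> y else 0))"
  proof (intro sum.cong refl)
    fix y :: nat assume "y \<in> {1..7}"
    then have y: "1 \<le> y" "y \<le> 7" by auto
    define a b where "a = stay_mass \<epsilon> y" and "b = shift_mass \<epsilon> y"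
    have ab: "0 < a" "0 < b" using stay_mass_pos shift_mass_pos y by (auto simp: a_def b_def)
    \<comment> \<open>The ambiguity counts exactly when \<open>S\<close> fails to separate the two
      levels and \<open>T\<close> separates them. Otherwise the posterior of the true
      \<open>T\<close> value is 1.\<close>
    let ?C = "S (\<sigma> ! (y - 1)) = S (\<sigma> ! y) \<and> T (\<sigma> ! (y - 1)) \<noteq> T (\<sigma> ! y)"
    \<comment> \<open>Splits off the prior 1/m; what remains is the log of the inverse posterior
      v/u.\<close>
    have ratio: "log 2 (u / (1 / m * v)) = log 2 m - log 2 (v / u)" if "0 < u" "0 < v" for u v :: real
      using that m by (simp add: log_divide log_mult)
    have out: "pmf (map_pmf V p) (V (x, y)) = a * of_bool (S (\<sigma> ! y) = S x) + b * of_bool (S (\<sigma> ! (y - 1)) = S x)"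
      "pmf (map_pmf J p) (J (x, y)) = a * of_bool ((T (\<sigma> ! y), S (\<sigma> ! y)) = (T x, S x)) +
        b * of_bool ((T (\<sigma> ! (y - 1)), S (\<sigma> ! (y - 1))) = (T x, S x))" for x
      using pmf_map_output[of V S, OF V y(2)] pmf_map_output[of J "\<lambda>x. (T x, S x)", OF J y(2)] y(1)
      by (simp_all add: a_def b_def)
    have G1: "G (\<sigma> ! y, y) = log 2 m - (if ?C then log 2 ((a + b) / a) else 0)"
      unfolding G_def out using ab by (subst ratio) (auto intro: add_pos_nonneg)
    have G2: "G (\<sigma> ! (y - 1), y) = log 2 m - (if ?C then log 2 ((a + b) / b) else 0)"
      unfolding G_def out using ab by (subst ratio) (auto intro: add_nonneg_pos)
    show "stay_mass \<epsilon> y * G (\<sigma> ! y, y) + shift_mass \<epsilon> y * G (\<sigma> ! (y - 1), y) =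
      (stay_mass \<epsilon> y + shift_mass \<epsilon> y) * log 2 m - (if ?C then ambiguity \<epsilon> y else 0)"
      unfolding ambiguity_def a_def[symmetric] b_def[symmetric] G1 G2 by (simp add: algebra_simps)
  qed
  also have "stay_mass \<epsilon> 0 * log 2 m + \<dots> =
      (stay_mass \<epsilon> 0 + (\<Sum>y=1..7. stay_mass \<epsilon> y + shift_mass \<epsilon> y)) * log 2 m - equivocation S T"
    by (simp add: equivocation_def sum_subtractf sum_distrib_right distrib_right)
  finally show ?thesis by (simp only: total_mass mult_1)
qed

text \<open>Independence gives I(T;S) = 0, so the chain rule reduces I(T;Y|S) to I(T;Y,S).\<close>

lemma cond_mutual_info_input_output:
  fixes T :: "bits3 \<Rightarrow> 'a::countable" and S :: "bits3 \<Rightarrow> 'b::countable"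
  assumes T: "\<And>x. card {x'. T x' = T x} * m = 8"
    and "\<And>x. 8 * card {x'. T x' = T x \<and> S x' = S x} = card {x'. T x' = T x} * card {x'. S x' = S x}"
  shows "cond_mutual_info p (T \<circ> fst) Y (S \<circ> fst) = log 2 m - equivocation S T"
  using mutual_info_inputs_indep[OF assms(2)]
    mutual_info_input_output[of "joint Y (S \<circ> fst)" S T m, OF _ T]
  by (auto simp: cond_mutual_info_chain joint_def Y_def)

section \<open>The informations that bound the rates\<close>

text \<open>Reduces the fibre-counting hypotheses to evaluation at the eight strings.\<close>

lemma card_bits3:
  "card {x. P x} =
    of_bool (P (False, False, False)) + of_bool (P (False, False, True)) +
    of_bool (P (False, True, False)) + of_bool (P (False, True, True)) +
    of_bool (P (True, False, False)) + of_bool (P (True, False, True)) +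
    of_bool (P (True, True, False)) + of_bool (P (True, True, True))" for P :: "bits3 \<Rightarrow> bool"
proof -
  have "card {x. P x} = (\<Sum>x\<in>UNIV \<times> UNIV \<times> UNIV. of_bool (P x))"
    by simp
  also have "\<dots> = (\<Sum>a\<in>UNIV. \<Sum>b\<in>UNIV. \<Sum>c\<in>UNIV. of_bool (P (a, b, c)))"
    by (simp only: sum.cartesian_product' split_def prod.collapse)
  finally show ?thesis by (simp add: UNIV_bool)
qed

text \<open>The constant map to \<open>()\<close> stands for absent side information; m is 2 for one
  bit and 8 for all three.\<close>

lemma mutual_info_values:
  "mutual_info p X1 Y = 1 - equivocation (\<lambda>_. ()) fst"
  "mutual_info p X2 Y = 1 - equivocation (\<lambda>_. ()) (fst \<circ> snd)"
  "mutual_info p X3 Y = 1 - equivocation (\<lambda>_. ()) (snd \<circ> snd)"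
  "mutual_info p (joint X1 (joint X2 X3)) Y = 3 - equivocation (\<lambda>_. ()) (\<lambda>x. x)"
proof -
  have "log 2 8 = log 2 (2 ^ 3)" by simp
  also have "\<dots> = (3::real)" by (subst log_nat_power) auto
  finally have log8: "log 2 8 = (3::real)" .
  have Y: "Y (x, y) = Y (x', y') \<longleftrightarrow> y = y' \<and> () = ()" for x x' y y'
    by (simp add: Y_def)
  show "mutual_info p X1 Y = 1 - equivocation (\<lambda>_. ()) fst"
    unfolding X_comp by (subst mutual_info_input_output[OF Y, where m = 2]) (auto simp: card_bits3)
  show "mutual_info p X2 Y = 1 - equivocation (\<lambda>_. ()) (fst \<circ> snd)"
    unfolding X_comp by (subst mutual_info_input_output[OF Y, where m = 2]) (auto simp: card_bits3)
  show "mutual_info p X3 Y = 1 - equivocation (\<lambda>_. ()) (snd \<circ> snd)"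
    unfolding X_comp by (subst mutual_info_input_output[OF Y, where m = 2]) (auto simp: card_bits3)
  show "mutual_info p (joint X1 (joint X2 X3)) Y = 3 - equivocation (\<lambda>_. ()) (\<lambda>x. x)"
    unfolding X_comp joint_comp
    by (subst mutual_info_input_output[OF Y, where m = 8]) (auto simp: card_bits3 log8)
qed

text \<open>Here \<open>S\<close> reads the conditioning bits, and m is 2 or 4 according to the
  number of remaining bits.\<close>

lemma cond_mutual_info_values:
  "cond_mutual_info p X1 Y (joint X2 X3) = 1 - equivocation snd fst"
  "cond_mutual_info p X2 Y (joint X1 X3) = 1 - equivocation (\<lambda>x. (fst x, snd (snd x))) (fst \<circ> snd)"
  "cond_mutual_info p X3 Y (joint X1 X2) = 1 - equivocation (\<lambda>x. (fst x, fst (snd x))) (snd \<circ> snd)"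
  "cond_mutual_info p (joint X1 X2) Y X3 = 2 - equivocation (snd \<circ> snd) (\<lambda>x. (fst x, fst (snd x)))"
  "cond_mutual_info p (joint X1 X3) Y X2 = 2 - equivocation (fst \<circ> snd) (\<lambda>x. (fst x, snd (snd x)))"
  "cond_mutual_info p (joint X2 X3) Y X1 = 2 - equivocation fst snd"
proof -
  have "log 2 4 = log 2 (2 ^ 2)" by simp
  also have "\<dots> = (2::real)" by (subst log_nat_power) auto
  finally have log4: "log 2 4 = (2::real)" .
  show "cond_mutual_info p X1 Y (joint X2 X3) = 1 - equivocation snd fst"
    unfolding X_comp joint_comp
    by (subst cond_mutual_info_input_output[where m = 2]) (auto simp: card_bits3)
  show "cond_mutual_info p X2 Y (joint X1 X3) = 1 - equivocation (\<lambda>x. (fst x, snd (snd x))) (fst \<circ> snd)"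
    unfolding X_comp joint_comp
    by (subst cond_mutual_info_input_output[where m = 2]) (auto simp: card_bits3)
  show "cond_mutual_info p X3 Y (joint X1 X2) = 1 - equivocation (\<lambda>x. (fst x, fst (snd x))) (snd \<circ> snd)"
    unfolding X_comp joint_comp
    by (subst cond_mutual_info_input_output[where m = 2]) (auto simp: card_bits3)
  show "cond_mutual_info p (joint X1 X2) Y X3 = 2 - equivocation (snd \<circ> snd) (\<lambda>x. (fst x, fst (snd x)))"
    unfolding X_comp joint_comp
    by (subst cond_mutual_info_input_output[where m = 4]) (auto simp: card_bits3 log4)
  show "cond_mutual_info p (joint X1 X3) Y X2 = 2 - equivocation (fst \<circ> snd) (\<lambda>x. (fst x, snd (snd x)))"
    unfolding X_comp joint_comp
    by (subst cond_mutual_info_input_output[where m = 4]) (auto simp: card_bits3 log4)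
  show "cond_mutual_info p (joint X2 X3) Y X1 = 2 - equivocation fst snd"
    unfolding X_comp joint_comp
    by (subst cond_mutual_info_input_output[where m = 4]) (auto simp: card_bits3 log4)
qed

lemma ambiguity_pos: "1 \<le> y \<Longrightarrow> y \<le> 7 \<Longrightarrow> 0 < ambiguity \<epsilon> y"
  unfolding ambiguity_def by (intro entropy_term_pos stay_mass_pos shift_mass_pos)

lemma ambiguity_le: "1 \<le> y \<Longrightarrow> y \<le> 7 \<Longrightarrow> ambiguity \<epsilon> y \<le> stay_mass \<epsilon> y + shift_mass \<epsilon> y"
  unfolding ambiguity_def by (intro entropy_term_le stay_mass_pos shift_mass_pos)

text \<open>Each ambiguity is at most P(Y = y); output 0 has positive probability and no ambiguity,
  which gives strictness.\<close>

lemma sum_ambiguity_less: "(\<Sum>y=1..7. ambiguity \<epsilon> y) < 1"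
proof -
  have "(\<Sum>y=1..7. ambiguity \<epsilon> y) \<le> (\<Sum>y=1..7. stay_mass \<epsilon> y + shift_mass \<epsilon> y)"
    by (intro sum_mono ambiguity_le) auto
  then show ?thesis using total_mass stay_mass_pos[of 0] by simp
qed

end

section \<open>Comparison of the regions\<close>

lemma sum_1_7: "(\<Sum>y=1..7. f y) = f 1 + f 2 + f 3 + f 4 + f 5 + f 6 + f 7" for f :: "nat \<Rightarrow> real"
  by (simp add: numeral_eq_Suc)

theorem theorem20:
  fixes \<epsilon> :: "nat \<Rightarrow> real"
  assumes "\<And>i. i \<le> 6 \<Longrightarrow> 0 < \<epsilon> i \<and> \<epsilon> i < 1"
  shows "TIN_region (tlc_channel \<epsilon>) natural_order_labeling \<subset> TIN_region (tlc_channel \<epsilon>) gray_labeling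
    \<and> TIN_region (tlc_channel \<epsilon>) gray_labeling = SC_region (tlc_channel \<epsilon>) gray_labeling
    \<and> SC_region (tlc_channel \<epsilon>) gray_labeling \<subset> SC_region (tlc_channel \<epsilon>) natural_order_labeling"
proof -
  interpret G: tlc \<epsilon> gray_labeling using assms by unfold_locales auto
  interpret N: tlc \<epsilon> natural_order_labeling using assms by unfold_locales auto
  define h where "h = ambiguity \<epsilon>"
  have h: "0 < h 1" "0 < h 2" "0 < h 3" "0 < h 4" "0 < h 5" "0 < h 6" "0 < h 7"
    "h 1 + h 2 + h 3 + h 4 + h 5 + h 6 + h 7 < 1"
    using G.ambiguity_pos[of 1] G.ambiguity_pos[of 2] G.ambiguity_pos[of 3] G.ambiguity_pos[of 4]
      G.ambiguity_pos[of 5] G.ambiguity_pos[of 6] G.ambiguity_pos[of 7] G.sum_ambiguity_less[unfolded sum_1_7]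
    by (simp_all add: h_def)
  \<comment> \<open>Along the Gray labeling bit 1 flips at y = 4, bit 2 at y = 2 and 6, bit 3 at odd
    y.\<close>
  have tin_G: "TIN_region (tlc_channel \<epsilon>) gray_labeling = {(R1, R2, R3).
      0 \<le> R1 \<and> R1 \<le> 1 - h 4 \<and> 0 \<le> R2 \<and> R2 \<le> 1 - (h 2 + h 6) \<and>
      0 \<le> R3 \<and> R3 \<le> 1 - (h 1 + h 3 + h 5 + h 7)}"
    unfolding TIN_region_def Let_def G.mutual_info_values G.equivocation_def sum_1_7 h_def[symmetric]
    by (simp add: gray_labeling_def)
  \<comment> \<open>In natural order bit 3 flips at every y, bit 2 at y = 2, 4, 6, and bit 1 at y =
    4.\<close>
  have tin_N: "TIN_region (tlc_channel \<epsilon>) natural_order_labeling = {(R1, R2, R3).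
      0 \<le> R1 \<and> R1 \<le> 1 - h 4 \<and> 0 \<le> R2 \<and> R2 \<le> 1 - (h 2 + h 4 + h 6) \<and>
      0 \<le> R3 \<and> R3 \<le> 1 - (h 1 + h 2 + h 3 + h 4 + h 5 + h 6 + h 7)}"
    unfolding TIN_region_def Let_def N.mutual_info_values N.equivocation_def sum_1_7 h_def[symmetric]
    by (simp add: natural_order_labeling_def)
  have sc_G: "SC_region (tlc_channel \<epsilon>) gray_labeling = {(R1, R2, R3).
      0 \<le> R1 \<and> 0 \<le> R2 \<and> 0 \<le> R3 \<and> R1 \<le> 1 - h 4 \<and> R2 \<le> 1 - (h 2 + h 6) \<and>
      R3 \<le> 1 - (h 1 + h 3 + h 5 + h 7) \<and> R1 + R2 \<le> 2 - (h 2 + h 4 + h 6) \<and>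
      R1 + R3 \<le> 2 - (h 1 + h 3 + h 4 + h 5 + h 7) \<and>
      R2 + R3 \<le> 2 - (h 1 + h 2 + h 3 + h 5 + h 6 + h 7) \<and>
      R1 + R2 + R3 \<le> 3 - (h 1 + h 2 + h 3 + h 4 + h 5 + h 6 + h 7)}"
    unfolding SC_region_def Let_def G.mutual_info_values G.cond_mutual_info_values
      G.equivocation_def sum_1_7 h_def[symmetric]
    by (simp add: gray_labeling_def)
  have sc_N: "SC_region (tlc_channel \<epsilon>) natural_order_labeling = {(R1, R2, R3).
      0 \<le> R1 \<and> 0 \<le> R2 \<and> 0 \<le> R3 \<and> R1 \<le> 1 \<and> R2 \<le> 1 \<and>
      R3 \<le> 1 - (h 1 + h 3 + h 5 + h 7) \<and> R1 + R2 \<le> 2 \<and>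
      R1 + R3 \<le> 2 - (h 1 + h 3 + h 5 + h 7) \<and>
      R2 + R3 \<le> 2 - (h 1 + h 2 + h 3 + h 5 + h 6 + h 7) \<and>
      R1 + R2 + R3 \<le> 3 - (h 1 + h 2 + h 3 + h 4 + h 5 + h 6 + h 7)}"
    unfolding SC_region_def Let_def N.mutual_info_values N.cond_mutual_info_values
      N.equivocation_def sum_1_7 h_def[symmetric]
    by (simp add: natural_order_labeling_def)
  \<comment> \<open>Each pairwise or triple bound of \<open>sc_G\<close> is the sum of the
    individual bounds.\<close>
  have eq: "TIN_region (tlc_channel \<epsilon>) gray_labeling = SC_region (tlc_channel \<epsilon>) gray_labeling"
    unfolding tin_G sc_G by auto
  have "TIN_region (tlc_channel \<epsilon>) natural_order_labeling \<subseteq> TIN_region (tlc_channel \<epsilon>) gray_labeling"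
    unfolding tin_G tin_N using h by auto
  \<comment> \<open>The largest Gray rate for input 2 exceeds the natural order bound by
    \<open>h 4\<close>; it is nonnegative since the ambiguities sum to less than 1.\<close>
  moreover have "(0, 1 - (h 2 + h 6), 0) \<in> TIN_region (tlc_channel \<epsilon>) gray_labeling"
    "(0, 1 - (h 2 + h 6), 0) \<notin> TIN_region (tlc_channel \<epsilon>) natural_order_labeling"
    unfolding tin_G tin_N using h by auto
  moreover have "SC_region (tlc_channel \<epsilon>) gray_labeling \<subseteq> SC_region (tlc_channel \<epsilon>) natural_order_labeling"
    unfolding sc_G sc_N using h by auto
  \<comment> \<open>Full rate for input 1 exceeds the Gray bound by \<open>h 4\<close>. In natural
    order, conditioning on the other two bits resolves the ambiguity at y = 4, and the sum bounds
    stay above 1.\<close>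
  moreover have "(1, 0, 0) \<notin> SC_region (tlc_channel \<epsilon>) gray_labeling"
    "(1, 0, 0) \<in> SC_region (tlc_channel \<epsilon>) natural_order_labeling"
    unfolding sc_G sc_N using h by auto
  ultimately show ?thesis using eq by blast
qed

end
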